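(* Let $d\geqslant1$, $\alpha\in(0,2)$, let $A$ be a real $d\times d$ matrix, and let $(Z_t)_{t\geqslant0}$ be a $d$-dimensional symmetric $\alpha$-stable process with generator $-(-\Delta)^{\alpha/2}$. Let $(X_t)_{t\geqslant0}$ be the Ornstein–Uhlenbeck process driven by $(Z_t)_{t\geqslant0}$, i.e. the unique strong solution on $\mathbb{R}^d$ of $$\mathrm{d}X_t=AX_t\,\mathrm{d}t+\mathrm{d}Z_t,\qquad X_0=x .$$ Then $(X_t)_{t\geqslant0}$ is not strongly ergodic.
   Context: The generator of $(Z_t)_{t\geqslant 0}$ is $$-(-\Delta)^{\alpha/2}f(x)=\int_{\mathbb{R}^d\setminus\{0\}}\left(f(x+z)-f(x)-\nabla f(x)\cdot z\,\mathbf{1}_{\{|z|\leqslant1\}}\right)\frac{C_{d,\alpha}}{|z|^{d+\alpha}}\,\mathrm{d}z,\qquad C_{d,\alpha}=\frac{\alpha2^{\alpha-1}\Gamma((d+\alpha)/2)}{\pi^{d/2}\Gamma(1-\alpha/2)},$$ where $C_{d,\alpha}$ is the normalizing constant for which the Fourier transform of $-(-\Delta)^{\alpha/2}u$ is $-|\xi|^\alpha\hat u(\xi)$. A Markov process on $\mathbb{R}^d$ with transition function $P_t(x,\cdot)$ is strongly ergodic if there exist $\varepsilon>0$, $C>0$ and an invariant probability measure $\pi$ such that $\sup_{x\in\mathbb{R}^d}\|P_t(x,\cdot)-\pi\|_{\mathrm{Var}}\leqslant Ce^{-\varepsilon t}$ for all $t\geqslant0$, where $\|\cdot\|_{\mathrm{Var}}$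 is the total variation distance. *)

theory Defs
  imports "HOL-Probability.Probability"
begin

definition cadlag :: "(real \<Rightarrow> 'v::topological_space) \<Rightarrow> bool" where
  "cadlag f \<longleftrightarrow>
     (\<forall>t\<ge>0. continuous (at_right t) f) \<and> (\<forall>t>0. \<exists>l. (f \<longlongrightarrow> l) (at_left t))"

text \<open>Processes are indexed by the type \<^typ>\<open>real\<close>; only times \<open>t \<ge> 0\<close> are meaningful.\<close>

definition levy_process :: "'w measure \<Rightarrow> (real \<Rightarrow> 'w \<Rightarrow> 'v::euclidean_space) \<Rightarrow> bool" where
  "levy_process M Z \<longleftrightarrow>
     prob_space M \<and>
     (\<forall>t\<ge>0. Z t \<in> borel_measurable M) \<and>
     (AE \<omega> in M. Z 0 \<omega> = 0) \<and>
     (\<forall>(n::nat) \<tau>. 0 \<le> \<tau> 0 \<and> mono \<tau> \<longrightarrow>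
        prob_space.indep_vars M (\<lambda>_. borel) (\<lambda>i \<omega>. Z (\<tau> (Suc i)) \<omega> - Z (\<tau> i) \<omega>) {..<n}) \<and>
     (\<forall>s\<ge>0. \<forall>t\<ge>0. distr M borel (\<lambda>\<omega>. Z (s + t) \<omega> - Z s \<omega>) = distr M borel (Z t)) \<and>
     (AE \<omega> in M. cadlag (\<lambda>t. Z t \<omega>))"

definition frac_laplacian_const :: "nat \<Rightarrow> real \<Rightarrow> real" where
  "frac_laplacian_const d \<alpha> =
     \<alpha> * 2 powr (\<alpha> - 1) * Gamma ((real d + \<alpha>) / 2) / (pi powr (real d / 2) * Gamma (1 - \<alpha> / 2))"

text \<open>The operator \<open>-(-\<Delta>)^(\<alpha>/2)\<close>, including the leading minus sign; the Frechet derivative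
  of \<open>f\<close> at \<open>x\<close> applied to \<open>z\<close> is the term \<open>\<nabla>f(x) \<cdot> z\<close>.\<close>

definition neg_frac_laplacian ::
  "real \<Rightarrow> (real ^ 'd \<Rightarrow> real) \<Rightarrow> real ^ 'd \<Rightarrow> real" where
  "neg_frac_laplacian \<alpha> f x =
     (LINT z:- {0}|lborel.
        (f (x + z) - f x - frechet_derivative f (at x) z * indicator {z. norm z \<le> 1} z)
        * (frac_laplacian_const CARD('d) \<alpha> / norm z powr (real CARD('d) + \<alpha>)))"

definition C2_compact_support :: "('v::euclidean_space \<Rightarrow> real) \<Rightarrow> bool" where
  "C2_compact_support f \<longleftrightarrow>
     (\<exists>(g :: 'v \<Rightarrow> 'v) (H :: 'v \<Rightarrow> 'v \<Rightarrow>\<^sub>L 'v).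
        (\<forall>x. (f has_derivative (\<lambda>h. g x \<bullet> h)) (at x)) \<and>
        (\<forall>x. (g has_derivative blinfun_apply (H x)) (at x)) \<and>
        continuous_on UNIV H) \<and>
     compact (closure {x. f x \<noteq> 0})"

text \<open>The infinitesimal generator of the Feller semigroup \<open>f \<mapsto> E f(\<sqdot> + Z\<^sub>t)\<close> (a limit in supremum
  norm) acts on the core of compactly supported \<open>C\<^sup>2\<close> functions as the operator \<open>L\<close>.\<close>

definition has_generator ::
  "'w measure \<Rightarrow> (real \<Rightarrow> 'w \<Rightarrow> 'v::euclidean_space) \<Rightarrow> (('v \<Rightarrow> real) \<Rightarrow> 'v \<Rightarrow> real) \<Rightarrow> bool" where
  "has_generator M Z L \<longleftrightarrow>
     (\<forall>f. C2_compact_support f \<longrightarrow>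
        uniform_limit UNIV (\<lambda>t x. ((LINT \<omega>|M. f (x + Z t \<omega>)) - f x) / t) (L f) (at_right 0))"

definition symmetric_stable_process ::
  "'w measure \<Rightarrow> real \<Rightarrow> (real \<Rightarrow> 'w \<Rightarrow> real ^ 'd) \<Rightarrow> bool" where
  "symmetric_stable_process M \<alpha> Z \<longleftrightarrow>
     levy_process M Z \<and>
     (\<forall>t\<ge>0. distr M borel (\<lambda>\<omega>. - Z t \<omega>) = distr M borel (Z t)) \<and>
     (\<forall>c>0. \<forall>t\<ge>0. distr M borel (Z (c * t)) = distr M borel (\<lambda>\<omega>. c powr (1 / \<alpha>) *\<^sub>R Z t \<omega>)) \<and>
     has_generator M Z (neg_frac_laplacian \<alpha>)"

text \<open>The natural filtration of \<open>Z\<close>, augmented by the null sets of \<open>M\<close>.\<close>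

definition augmented_filtration ::
  "'w measure \<Rightarrow> (real \<Rightarrow> 'w \<Rightarrow> 'v::topological_space) \<Rightarrow> real \<Rightarrow> 'w measure" where
  "augmented_filtration M Z t =
     sigma (space M)
       ({Z s -` B \<inter> space M | s B. 0 \<le> s \<and> s \<le> t \<and> B \<in> sets borel} \<union> null_sets M)"

text \<open>\<open>Y\<close> is a strong solution of \<open>dY\<^sub>t = A Y\<^sub>t dt + dZ\<^sub>t\<close>, \<open>Y\<^sub>0 = x\<close>; the noise is additive, so
  the stochastic integral is just \<open>Z\<^sub>t - Z\<^sub>0 = Z\<^sub>t\<close>.\<close>

definition ou_strong_solution ::
  "'w measure \<Rightarrow> (real \<Rightarrow> 'w \<Rightarrow> real ^ 'd) \<Rightarrow> real ^ 'd ^ 'd \<Rightarrow> real ^ 'd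
    \<Rightarrow> (real \<Rightarrow> 'w \<Rightarrow> real ^ 'd) \<Rightarrow> bool" where
  "ou_strong_solution M Z A x Y \<longleftrightarrow>
     (\<forall>t\<ge>0. Y t \<in> borel_measurable (augmented_filtration M Z t)) \<and>
     (AE \<omega> in M. cadlag (\<lambda>t. Y t \<omega>)) \<and>
     (AE \<omega> in M. \<forall>t\<ge>0.
        (\<lambda>s. A *v Y s \<omega>) absolutely_integrable_on {0..t} \<and>
        Y t \<omega> = x + integral {0..t} (\<lambda>s. A *v Y s \<omega>) + Z t \<omega>)"

text \<open>\<open>P t x\<close> stands for \<open>P\<^sub>t(x, \<sqdot>)\<close>. All suprema below are over bounded families
  when the measures involved are probability measures on the Borel sets.\<close>

definition tv_dist :: "'v::topological_space measure \<Rightarrow> 'v measure \<Rightarrow> real" where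
  "tv_dist \<mu> \<nu> = (SUP B\<in>sets borel. \<bar>measure \<mu> B - measure \<nu> B\<bar>)"

definition invariant_prob ::
  "(real \<Rightarrow> 'v::topological_space \<Rightarrow> 'v measure) \<Rightarrow> 'v measure \<Rightarrow> bool" where
  "invariant_prob P \<pi> \<longleftrightarrow>
     prob_space \<pi> \<and> sets \<pi> = sets borel \<and>
     (\<forall>t\<ge>0. \<forall>B\<in>sets borel. (\<integral>\<^sup>+ x. emeasure (P t x) B \<partial>\<pi>) = emeasure \<pi> B)"

definition strongly_ergodic ::
  "(real \<Rightarrow> 'v::topological_space \<Rightarrow> 'v measure) \<Rightarrow> bool" where
  "strongly_ergodic P \<longleftrightarrow>
     (\<exists>\<epsilon>>0. \<exists>C>0. \<exists>\<pi>. invariant_prob P \<pi> \<and>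
        (\<forall>t\<ge>0. (SUP x. tv_dist (P t x) \<pi>) \<le> C * exp (- \<epsilon> * t)))"

definition transition_function ::
  "'w measure \<Rightarrow> ('v \<Rightarrow> real \<Rightarrow> 'w \<Rightarrow> 'v::topological_space) \<Rightarrow> real \<Rightarrow> 'v \<Rightarrow> 'v measure" where
  "transition_function M X t x = distr M borel (X x t)"

end

theory Submission
  imports Defs "HOL-Real_Asymp.Real_Asymp"
begin

text \<open>Two solutions driven by the same noise differ by a solution of the linear equation
  \<open>D' = A D\<close>, whose norm decays at most exponentially fast. For fixed \<open>t\<close> the law of \<open>X\<^sub>t\<close> started
  from a far away point \<open>x\<close> therefore puts almost no mass on a ball that carries most of the
  mass of \<open>\<pi>\<close>, so the supremum over \<open>x\<close> of the distances to \<open>\<pi>\<close> never drops below one half.\<close>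

text \<open>Energy estimate: along \<open>D' = L D\<close> the derivative of
  \<open>D \<bullet> D\<close> is \<open>2 * (D \<bullet> L D)\<close>, which Cauchy-Schwarz bounds
  below by \<open>- 2 * K * (D \<bullet> D)\<close>. The squared norm therefore cannot decay faster
  than \<open>exp (- 2 * K * s)\<close>.\<close>

lemma linear_ode_lower_bound:
  fixes D :: "real \<Rightarrow> 'v::euclidean_space"
  assumes "bounded_linear L" and K: "\<And>v. norm (L v) \<le> K * norm v" and "0 \<le> t"
    and int: "(\<lambda>s. L (D s)) integrable_on {0..t}"
    and D: "\<And>s. 0 \<le> s \<Longrightarrow> s \<le> t \<Longrightarrow> D s = x + integral {0..s} (\<lambda>u. L (D u))"
  shows "norm x \<le> exp (K * t) * norm (D t)"
proof -
  \<comment> \<open>Regularity is bootstrapped from the integral equation, as \<open>D\<close> is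
    not assumed continuous: an indefinite integral is continuous, so \<open>D\<close> and then the
    integrand \<open>L (D s)\<close> are continuous, and the fundamental theorem of calculus makes
    \<open>D\<close> differentiable.\<close>
  have "continuous_on {0..t} (\<lambda>s. x + integral {0..s} (\<lambda>u. L (D u)))"
    by (intro continuous_intros indefinite_integral_continuous_1 int)
  then have contD: "continuous_on {0..t} D"
    by (rule continuous_on_eq) (simp add: D)
  then have contLD: "continuous_on {0..t} (\<lambda>s. L (D s))"
    by (rule bounded_linear.continuous_on[OF assms(1)])
  have derivD: "(D has_vector_derivative L (D s)) (at s)" if s: "0 < s" "s < t" for s
  proof -
    have "((\<lambda>s. x + integral {0..s} (\<lambda>u. L (D u))) has_vector_derivative 0 + L (D s))
        (at s within {0..t})"
      using s by (intro derivative_intros integral_has_vector_derivative contLD) auto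
    then have "(D has_vector_derivative L (D s)) (at s within {0..t})"
      using s by (auto intro: has_vector_derivative_transform simp: D)
    then show ?thesis
      using s by (simp add: at_within_Icc_at)
  qed
  \<comment> \<open>The exponential weight turns the decay estimate into monotonicity of
    \<open>g\<close>; squaring the norm avoids its lack of differentiability at 0.\<close>
  define g where "g s = exp (2 * K * s) * (D s \<bullet> D s)" for s
  have "g 0 \<le> g t"
  proof (rule DERIV_nonneg_imp_increasing_open[OF \<open>0 \<le> t\<close>])
    show "continuous_on {0..t} g"
      unfolding g_def by (intro continuous_intros contD)
    fix s assume s: "0 < s" "s < t"
    let ?y = "exp (2 * K * s) * (2 * K * (D s \<bullet> D s) + 2 * (D s \<bullet> L (D s)))"
    have "DERIV g s :> ?y"
      unfolding g_def has_field_derivative_def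
      using derivD[OF s, unfolded has_vector_derivative_def]
      by (auto intro!: derivative_eq_intros simp: fun_eq_iff algebra_simps inner_commute)
    moreover have "- (D s \<bullet> L (D s)) \<le> K * (D s \<bullet> D s)"
    proof -
      have "- (D s \<bullet> L (D s)) \<le> norm (D s) * norm (L (D s))"
        using Cauchy_Schwarz_ineq2[of "D s" "L (D s)"] by linarith
      also have "\<dots> \<le> norm (D s) * (K * norm (D s))"
        by (intro mult_left_mono K) simp
      finally show ?thesis
        by (simp add: dot_square_norm power2_eq_square algebra_simps)
    qed
    then have "?y \<ge> 0"
      by simp
    ultimately show "\<exists>y. DERIV g s :> y \<and> y \<ge> 0"
      by blast
  qed
  moreover have "D 0 = x"
    using D[of 0] \<open>0 \<le> t\<close> by simp
  ultimately have "(norm x)\<^sup>2 \<le> (exp (K * t) * norm (D t))\<^sup>2"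
    by (simp add: g_def dot_square_norm power_mult_distrib exp_double mult.assoc)
  then show ?thesis
    by (rule power2_le_imp_le) simp
qed

text \<open>The noise is additive, so it cancels pathwise in \<open>X - Y\<close>, jumps included.
  What remains is a deterministic linear equation started at \<open>x - y\<close>, and the bound has
  no random constant.\<close>

lemma ou_solutions_diverge:
  assumes X: "ou_strong_solution M Z A x X" and Y: "ou_strong_solution M Z A y Y"
    and "\<And>v. norm (A *v v) \<le> K * norm v" and "0 \<le> t"
  shows "AE \<omega> in M. norm (x - y) \<le> exp (K * t) * norm (X t \<omega> - Y t \<omega>)"
proof -
  let ?sol = "\<lambda>x X \<omega>. \<forall>t\<ge>0. (\<lambda>s. A *v X s \<omega>) absolutely_integrable_on {0..t} \<and>
    X t \<omega> = x + integral {0..t} (\<lambda>s. A *v X s \<omega>) + Z t \<omega>"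
  have "AE \<omega> in M. ?sol x X \<omega>" "AE \<omega> in M. ?sol y Y \<omega>"
    using X Y unfolding ou_strong_solution_def by blast+
  then show ?thesis
  proof eventually_elim
    case (elim \<omega>)
    have int: "(\<lambda>s. A *v X s \<omega>) integrable_on {0..s}" "(\<lambda>s. A *v Y s \<omega>) integrable_on {0..s}"
      if "0 \<le> s" for s
      using elim that by (auto intro: set_lebesgue_integral_eq_integral(1))
    show ?case
    proof (rule linear_ode_lower_bound[where L = "(*v) A" and D = "\<lambda>s. X s \<omega> - Y s \<omega>"])
      show "(\<lambda>s. A *v (X s \<omega> - Y s \<omega>)) integrable_on {0..t}"
        using int[OF \<open>0 \<le> t\<close>] by (simp add: matrix_vector_mult_diff_distrib integrable_diff)
    next
      fix s :: real assume "0 \<le> s"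
      then show "X s \<omega> - Y s \<omega> = x - y + integral {0..s} (\<lambda>u. A *v (X u \<omega> - Y u \<omega>))"
        using elim int[OF \<open>0 \<le> s\<close>]
        by (simp add: matrix_vector_mult_diff_distrib integral_diff)
    qed (use assms in \<open>auto simp: matrix_vector_mul_bounded_linear\<close>)
  qed
qed

text \<open>Transition laws are images of \<open>M\<close>, whereas a solution is only known to be
  measurable for the augmented filtration. The generators of the latter, preimages under
  \<open>Z s\<close> and null sets, are all events of \<open>M\<close>.\<close>

lemma ou_strong_solution_measurable:
  assumes "levy_process M Z" and "ou_strong_solution M Z A x Y" and "0 \<le> t"
  shows "Y t \<in> borel_measurable M"
proof -
  define G where "G = {Z s -` B \<inter> space M | s B. 0 \<le> s \<and> s \<le> t \<and> B \<in> sets borel} \<union> null_sets M"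
  have "Z s -` B \<inter> space M \<in> sets M" if "0 \<le> s" "B \<in> sets borel" for s B
    using assms(1) that unfolding levy_process_def by (auto intro: measurable_sets)
  then have "G \<subseteq> sets M"
    by (auto simp: G_def)
  then have "G \<subseteq> Pow (space M)" "sigma_sets (space M) G \<subseteq> sets M"
    using sets.space_closed[of M] by (simp_all add: sets.sigma_sets_subset)
  moreover have "augmented_filtration M Z t = sigma (space M) G"
    by (simp add: augmented_filtration_def G_def)
  ultimately have "sets (augmented_filtration M Z t) \<subseteq> sets M"
    and "space (augmented_filtration M Z t) = space M"
    by simp_all
  moreover have "Y t \<in> borel_measurable (augmented_filtration M Z t)"
    using assms unfolding ou_strong_solution_def by blast
  ultimately show ?thesis
    by (auto simp: measurable_def)
qed

lemma prob_cball_tendsto_1: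
  fixes N :: "'v::euclidean_space measure"
  assumes "prob_space N" and "sets N = sets borel"
  shows "(\<lambda>n. measure N (cball 0 (real n))) \<longlonglongrightarrow> 1"
proof -
  interpret prob_space N by fact
  have "(\<Union>n. cball (0::'v) (real n)) = UNIV"
    by (auto simp: real_arch_simple)
  moreover have "(\<lambda>n. measure N (cball 0 (real n))) \<longlonglongrightarrow> measure N (\<Union>n. cball 0 (real n))"
    by (rule finite_Lim_measure_incseq) (auto simp: assms(2) incseq_def)
  moreover have "space N = UNIV"
    using sets_eq_imp_space_eq[OF assms(2)] by simp
  ultimately show ?thesis
    using prob_space by simp
qed

text \<open>A real supremum is informative only over a bounded family. The bound by 1 provides this
  twice: for the supremum over Borel sets here, and later for the one over starting points.\<close>

lemma tv_dist_bounds: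
  assumes "prob_space \<mu>" and "prob_space \<nu>"
  shows tv_dist_le_1: "tv_dist \<mu> \<nu> \<le> 1"
    and tv_dist_ge: "B \<in> sets borel \<Longrightarrow> \<bar>measure \<mu> B - measure \<nu> B\<bar> \<le> tv_dist \<mu> \<nu>"
proof -
  interpret \<mu>: prob_space \<mu> by fact
  interpret \<nu>: prob_space \<nu> by fact
  have le: "\<bar>measure \<mu> B - measure \<nu> B\<bar> \<le> 1" for B
    using \<mu>.prob_le_1[of B] \<nu>.prob_le_1[of B] measure_nonneg[of \<mu> B] measure_nonneg[of \<nu> B]
    by linarith
  show "tv_dist \<mu> \<nu> \<le> 1"
    unfolding tv_dist_def by (rule cSUP_least) (use sets.empty_sets le in blast)+
  show "\<bar>measure \<mu> B - measure \<nu> B\<bar> \<le> tv_dist \<mu> \<nu>" if "B \<in> sets borel"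
    unfolding tv_dist_def by (rule cSUP_upper[OF that]) (rule bdd_aboveI2[OF le])
qed

theorem theorem4:
  fixes M :: "'w measure"
    and \<alpha> :: real
    and A :: "real ^ 'd ^ 'd"
    and Z :: "real \<Rightarrow> 'w \<Rightarrow> real ^ 'd"
    and X :: "real ^ 'd \<Rightarrow> real \<Rightarrow> 'w \<Rightarrow> real ^ 'd"
  assumes "0 < \<alpha>" and "\<alpha> < 2"
    and "symmetric_stable_process M \<alpha> Z"
    and "\<And>x. ou_strong_solution M Z A x (X x)"
  shows "\<not> strongly_ergodic (transition_function M X)"
proof
  let ?P = "transition_function M X"
  assume "strongly_ergodic ?P"
  then obtain \<epsilon> C \<pi> where "\<epsilon> > 0" and inv: "invariant_prob ?P \<pi>"
    and conv: "\<And>t. t \<ge> 0 \<Longrightarrow> (SUP x. tv_dist (?P t x) \<pi>) \<le> C * exp (- \<epsilon> * t)"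
    unfolding strongly_ergodic_def by blast
  have \<pi>: "prob_space \<pi>" "sets \<pi> = sets borel"
    using inv by (auto simp: invariant_prob_def)
  have levy: "levy_process M Z"
    using assms(3) by (simp add: symmetric_stable_process_def)
  then interpret prob_space M
    by (simp add: levy_process_def)
  have "((\<lambda>t. C * exp (- \<epsilon> * t)) \<longlongrightarrow> 0) at_top"
    using \<open>\<epsilon> > 0\<close> by real_asymp
  \<comment> \<open>A single time is enough for the contradiction; \<open>t\<close> stays fixed from
    here on, and \<open>n\<close> and \<open>x\<close> are chosen depending on it.\<close>
  then have "eventually (\<lambda>t. C * exp (- \<epsilon> * t) < 1 / 2) at_top"
    by (rule order_tendstoD) simp
  then obtain t where t: "t \<ge> 0" "C * exp (- \<epsilon> * t) < 1 / 2"
    using eventually_happens[OF eventually_conj[OF _ eventually_ge_at_top[of 0]]] by auto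
  have meas[measurable]: "X x t \<in> borel_measurable M" for x
    using ou_strong_solution_measurable[OF levy assms(4) t(1)] .
  have P: "prob_space (?P t x)" "sets (?P t x) = sets borel" for x
    by (auto simp: transition_function_def intro!: prob_space_distr)
  \<comment> \<open>One radius serves both laws. With mass above 3/4 under the law started from 0,
    less than 1/4 will be left for the far start, which gives a gap above 1/2 to
    \<open>\<pi>\<close>.\<close>
  obtain n :: nat where n: "measure \<pi> (cball 0 n) > 3 / 4" "measure (?P t 0) (cball 0 n) > 3 / 4"
    using eventually_happens[OF eventually_conj[OF
        order_tendstoD(1)[OF prob_cball_tendsto_1[OF \<pi>], of "3 / 4"]
        order_tendstoD(1)[OF prob_cball_tendsto_1[OF P(1,2)[of 0]], of "3 / 4"]]]
    by auto
  obtain K where K: "\<And>v. norm (A *v v) \<le> K * norm v"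
    using bounded_linear.bounded[OF matrix_vector_mul_bounded_linear[of A]]
    by (auto simp: mult.commute)
  \<comment> \<open>After the worst contraction, by the factor \<open>exp (- K * t)\<close>, the two
    paths are still at least \<open>2 * n + 1\<close> apart, more than the diameter
    \<open>2 * n\<close> of the ball.\<close>
  obtain x :: "real ^ 'd" where x: "norm x = exp (K * t) * (2 * n + 1)"
    using vector_choose_size[of "exp (K * t) * (2 * n + 1)"] by auto
  have far: "AE \<omega> in M. \<not> (X x t \<omega> \<in> cball 0 n \<and> X 0 t \<omega> \<in> cball 0 n)"
    using ou_solutions_diverge[OF assms(4)[of x] assms(4)[of 0] K t(1)]
  proof eventually_elim
    case (elim \<omega>)
    then have "2 * n + 1 \<le> norm (X x t \<omega> - X 0 t \<omega>)"
      by (simp add: x)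
    then show ?case
      using norm_triangle_ineq4[of "X x t \<omega>" "X 0 t \<omega>"] by auto
  qed
  \<comment> \<open>The solutions from \<open>x\<close> and from 0 live on the same space
    \<open>M\<close>, so their laws are coupled: the two events of lying in the ball are almost
    surely disjoint.\<close>
  have "measure (?P t x) (cball 0 n) + measure (?P t 0) (cball 0 n) \<le> 1"
  proof -
    let ?E = "\<lambda>y. {\<omega> \<in> space M. X y t \<omega> \<in> cball 0 n}"
    have E: "measure (?P t y) (cball 0 n) = prob (?E y)" for y
      by (simp add: transition_function_def measure_distr vimage_def Int_def conj_commute)
    have [simp]: "?E y \<in> events" for y
      using measurable_sets[OF meas, of "cball 0 n" y] by (simp add: vimage_def Int_def conj_commute)
    have "prob (?E x) \<le> prob (space M - ?E 0)"
      by (rule finite_measure_mono_AE) (use far in \<open>auto\<close>)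
    also have "\<dots> = 1 - prob (?E 0)"
      by (simp add: prob_compl)
    finally show ?thesis
      by (simp add: E)
  qed
  then have "1 / 2 < \<bar>measure (?P t x) (cball 0 n) - measure \<pi> (cball 0 n)\<bar>"
    using n by linarith
  also have "\<dots> \<le> tv_dist (?P t x) \<pi>"
    by (rule tv_dist_ge[OF P(1) \<pi>(1)]) simp
  also have "\<dots> \<le> (SUP x. tv_dist (?P t x) \<pi>)"
    by (rule cSUP_upper) (auto intro!: bdd_aboveI2 tv_dist_le_1 P \<pi>)
  also have "\<dots> < 1 / 2"
    using conv[OF t(1)] t(2) by linarith
  finally show False .
qed

end
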